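(* Let $\mu,r\geq0$ and $\alpha,\beta,\gamma,\delta\in\mathbb{R}$ be such that $\theta:=\beta(\mu+1)-\alpha >2$. Then $$\sum_{n=2}^\infty \frac{n^\alpha (\log n)^\gamma\sin(nx)}{\big(n^\beta (\log n)^\delta+r^2\big)^{\mu+1}} \sim x \sum_{n=2}^\infty \frac{n^{\alpha+1} (\log n)^\gamma}{\big(n^\beta (\log n)^\delta+r^2\big)^{\mu+1}}, \qquad x\downarrow 0.$$
   Context: Here $f(x)\sim g(x)$ as $x\downarrow 0$ means $f(x)/g(x)\to 1$, with all parameters $\mu,r,\alpha,\beta,\gamma,\delta$ fixed. *)

theory Defs
  imports Complex_Main "HOL-Library.Landau_Symbols"
begin

text \<open>All bases of \<open>powr\<close> below are strictly positive for \<open>n \<ge> 2\<close>.\<close>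

definition log_coeff :: "real \<Rightarrow> real \<Rightarrow> real \<Rightarrow> real \<Rightarrow> real \<Rightarrow> real \<Rightarrow> nat \<Rightarrow> real" where
  "log_coeff \<mu> r \<alpha> \<beta> \<gamma> \<delta> n =
     real n powr \<alpha> * ln (real n) powr \<gamma> /
       (real n powr \<beta> * ln (real n) powr \<delta> + r\<^sup>2) powr (\<mu> + 1)"

end

theory Submission
  imports Defs "HOL-Analysis.Analysis" "HOL-Real_Asymp.Real_Asymp"
begin

text \<open>
  Since \<open>r\<^sup>2\<close> only enlarges the denominator, the coefficients \<open>n a\<^sub>n\<close> are
  dominated by \<open>n\<close> to the power \<open>1 - \<theta> < -1\<close> times a power of \<open>ln n\<close>, hence summable. Dividing
  the sine series by \<open>x\<close>, each term tends to \<open>n a\<^sub>n\<close> and is bounded by it because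
  \<open>\<bar>sin t\<bar> \<le> \<bar>t\<bar>\<close>, so dominated convergence for series (Tannery's theorem) gives the limit
  \<open>\<Sum>n a\<^sub>n > 0\<close>.
\<close>

lemma log_coeff_pos:
  assumes "n \<ge> 2"
  shows "log_coeff \<mu> r \<alpha> \<beta> \<gamma> \<delta> n > 0"
proof -
  have "real n powr \<beta> * ln (real n) powr \<delta> + r\<^sup>2 > 0"
    using assms by (intro add_pos_nonneg mult_pos_pos) auto
  then show ?thesis
    using assms unfolding log_coeff_def by (intro divide_pos_pos mult_pos_pos) auto
qed

text \<open>The factor \<open>n\<close> is the slope of sin(n x) at 0, so the series with \<alpha> +
  1 is the formal derivative of the sine series there.\<close>

lemma log_coeff_add_1:
  assumes "n \<ge> 2"
  shows "log_coeff \<mu> r (\<alpha> + 1) \<beta> \<gamma> \<delta> n = real n * log_coeff \<mu> r \<alpha> \<beta> \<gamma> \<delta> n"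
  using assms unfolding log_coeff_def by (simp add: powr_add)

lemma log_coeff_le:
  assumes "n \<ge> 2" and "\<mu> \<ge> 0"
  shows "log_coeff \<mu> r \<alpha> \<beta> \<gamma> \<delta> n \<le>
    real n powr (\<alpha> - \<beta> * (\<mu> + 1)) * ln (real n) powr (\<gamma> - \<delta> * (\<mu> + 1))"
proof -
  let ?d = "real n powr \<beta> * ln (real n) powr \<delta>"
  have d: "?d > 0"
    using assms by (intro mult_pos_pos) auto
  then have d_add: "?d + r\<^sup>2 > 0"
    by (intro add_pos_nonneg) auto
  \<comment> \<open>Dropping the square of r shrinks the base; the power follows because \<mu> \<ge>
    0 makes the exponent nonnegative.\<close>
  have "log_coeff \<mu> r \<alpha> \<beta> \<gamma> \<delta> n \<le> real n powr \<alpha> * ln (real n) powr \<gamma> / ?d powr (\<mu> + 1)"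
    unfolding log_coeff_def using assms d d_add
    by (intro divide_left_mono powr_mono2 mult_pos_pos) (auto simp: less_imp_neq)
  also have "\<dots> = real n powr (\<alpha> - \<beta> * (\<mu> + 1)) * ln (real n) powr (\<gamma> - \<delta> * (\<mu> + 1))"
    using assms by (simp add: powr_diff powr_mult powr_powr)
  finally show ?thesis .
qed

lemma summable_powr_ln_powr:
  fixes s c :: real
  assumes "s < -1"
  shows "summable (\<lambda>n. real n powr s * ln (real n) powr c)"
proof (rule summable_comparison_test_bigo)
  \<comment> \<open>The midpoint of s and -1: still below -1, yet above s, and this gap absorbs any
    power of the logarithm.\<close>
  show "summable (\<lambda>n. norm (real n powr ((s - 1) / 2)))"
    using assms by (simp add: summable_real_powr_iff)
  show "(\<lambda>n. real n powr s * ln (real n) powr c) \<in> O(\<lambda>n. real n powr ((s - 1) / 2))"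
    using assms by real_asymp
qed

text \<open>The bound is 1 because the main use has \<alpha> + 1 in place of \<alpha>, which turns
  \<theta> > 2 into exactly this condition.\<close>

lemma summable_log_coeff:
  assumes "\<mu> \<ge> 0" and "\<beta> * (\<mu> + 1) - \<alpha> > 1"
  shows "summable (\<lambda>n. log_coeff \<mu> r \<alpha> \<beta> \<gamma> \<delta> (n + 2))"
proof (rule summable_comparison_test')
  show "summable (\<lambda>n. real (n + 2) powr (\<alpha> - \<beta> * (\<mu> + 1)) *
      ln (real (n + 2)) powr (\<gamma> - \<delta> * (\<mu> + 1)))"
    using assms(2) by (intro summable_ignore_initial_segment summable_powr_ln_powr) simp
  show "norm (log_coeff \<mu> r \<alpha> \<beta> \<gamma> \<delta> (n + 2)) \<le>
      real (n + 2) powr (\<alpha> - \<beta> * (\<mu> + 1)) * ln (real (n + 2)) powr (\<gamma> - \<delta> * (\<mu> + 1))" for n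
    using log_coeff_le[of "n + 2" \<mu> r \<alpha> \<beta> \<gamma> \<delta>] log_coeff_pos[of "n + 2" \<mu> r \<alpha> \<beta> \<gamma> \<delta>] assms(1)
    by simp
qed

lemma summable_mult_sin:
  fixes a m :: "nat \<Rightarrow> real"
  assumes "summable (\<lambda>n. \<bar>m n * a n\<bar>)"
  shows "summable (\<lambda>n. a n * sin (m n * x))"
proof (rule summable_comparison_test')
  show "summable (\<lambda>n. \<bar>x\<bar> * \<bar>m n * a n\<bar>)"
    using assms by (rule summable_mult)
  show "norm (a n * sin (m n * x)) \<le> \<bar>x\<bar> * \<bar>m n * a n\<bar>" for n
    using mult_left_mono[OF abs_sin_x_le_abs_x[of "m n * x"], of "\<bar>a n\<bar>"]
    by (simp add: abs_mult mult_ac)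
qed

text \<open>Only absolute summability of \<open>m n * a n\<close> matters for Tannery's theorem, so
  coefficients and frequencies are left arbitrary. A nonzero limit can be divided out, which turns
  convergence into a ratio tending to 1.\<close>

lemma sin_series_asymp_equiv:
  fixes a m :: "nat \<Rightarrow> real"
  assumes summable: "summable (\<lambda>n. \<bar>m n * a n\<bar>)" and nonzero: "(\<Sum>n. m n * a n) \<noteq> 0"
  shows "(\<lambda>x. \<Sum>n. a n * sin (m n * x)) \<sim>[at_right 0] (\<lambda>x. x * (\<Sum>n. m n * a n))"
proof (rule asymp_equivI')
  have "((\<lambda>x. \<Sum>n. a n * (sin (m n * x) / x)) \<longlongrightarrow> (\<Sum>n. m n * a n)) (at_right 0)"
  proof (rule tannerys_theorem[THEN conjunct2, THEN conjunct2])
    show "((\<lambda>x. a n * (sin (m n * x) / x)) \<longlongrightarrow> m n * a n) (at_right 0)" for n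
    proof -
      have "((\<lambda>x. sin (m n * x) / x) \<longlongrightarrow> m n) (at_right 0)"
        by real_asymp
      from tendsto_mult_left[OF this, of "a n"] show ?thesis
        by (simp add: mult.commute)
    qed
    \<comment> \<open>At x = 0 the quotient is 0 by convention, so the bound holds for every x and
      the filter imposes no restriction.\<close>
    have "norm (a n * (sin (m n * x) / x)) \<le> \<bar>m n * a n\<bar>" for n x
      using mult_left_mono[OF abs_sin_x_le_abs_x[of "m n * x"], of "\<bar>a n\<bar>"]
      by (cases "x = 0") (simp_all add: abs_mult field_simps)
    then show "\<forall>\<^sub>F (n, x) in at_top \<times>\<^sub>F at_right 0.
        norm (a n * (sin (m n * x) / x)) \<le> \<bar>m n * a n\<bar>"
      by (intro always_eventually) auto
  qed (use summable in auto)
  then have "((\<lambda>x. (\<Sum>n. a n * (sin (m n * x) / x)) / (\<Sum>n. m n * a n)) \<longlongrightarrow> 1) (at_right 0)"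
    using nonzero by (auto intro!: tendsto_eq_intros)
  \<comment> \<open>Moving 1 / x out of the series requires the sine series itself to
    converge.\<close>
  moreover have "(\<Sum>n. a n * (sin (m n * x) / x)) = (\<Sum>n. a n * sin (m n * x)) / x" for x
    using suminf_divide[OF summable_mult_sin[OF summable], of x x] by simp
  ultimately show
    "((\<lambda>x. (\<Sum>n. a n * sin (m n * x)) / (x * (\<Sum>n. m n * a n))) \<longlongrightarrow> 1) (at_right 0)"
    by simp
qed

theorem proposition4p4:
  fixes \<mu> r \<alpha> \<beta> \<gamma> \<delta> :: real
  assumes "\<mu> \<ge> 0" and "r \<ge> 0"
    and "\<beta> * (\<mu> + 1) - \<alpha> > 2"
  shows "(\<forall>x>0. summable (\<lambda>n. log_coeff \<mu> r \<alpha> \<beta> \<gamma> \<delta> (n + 2) * sin (real (n + 2) * x)))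
    \<and> summable (\<lambda>n. log_coeff \<mu> r (\<alpha> + 1) \<beta> \<gamma> \<delta> (n + 2))
    \<and> (\<lambda>x. \<Sum>n. log_coeff \<mu> r \<alpha> \<beta> \<gamma> \<delta> (n + 2) * sin (real (n + 2) * x))
        \<sim>[at_right 0]
      (\<lambda>x. x * (\<Sum>n. log_coeff \<mu> r (\<alpha> + 1) \<beta> \<gamma> \<delta> (n + 2)))"
proof -
  let ?a = "\<lambda>n. log_coeff \<mu> r \<alpha> \<beta> \<gamma> \<delta> (n + 2)"
  let ?b = "\<lambda>n. log_coeff \<mu> r (\<alpha> + 1) \<beta> \<gamma> \<delta> (n + 2)"
  have b: "?b n = real (n + 2) * ?a n" for n
    by (simp add: log_coeff_add_1)
  \<comment> \<open>Positivity serves twice: it makes the summability absolute, and it keeps the sum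
    away from 0.\<close>
  have b_pos: "?b n > 0" for n
    by (rule log_coeff_pos) simp
  have summable_b: "summable ?b"
    using assms by (intro summable_log_coeff) auto
  then have "summable (\<lambda>n. \<bar>?b n\<bar>)"
    by (simp only: abs_of_pos[OF b_pos])
  then have summable: "summable (\<lambda>n. \<bar>real (n + 2) * ?a n\<bar>)"
    by (simp only: b)
  have "suminf ?b \<noteq> 0"
    using suminf_pos[OF summable_b b_pos] by simp
  then have nonzero: "(\<Sum>n. real (n + 2) * ?a n) \<noteq> 0"
    unfolding b .
  show ?thesis
    using summable_b summable_mult_sin[OF summable] sin_series_asymp_equiv[OF summable nonzero]
    unfolding b by blast
qed

end
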